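(* For every integer $n\geq 1$, there exist an Abelian variety $A$ over $\mathbb{C}$ of dimension $\frac{\operatorname{lcm}(4,n)}{2}+1$ and a free action of the dihedral group $D_n$ of order $2n$ on $A$ that contains no translations.
   Context: For an integer $k\geq 1$, $D_k:=\langle r,s \mid r^k=1,\ s^2=1,\ (rs)^2=1\rangle$ denotes the dihedral group of order $2k$. $\operatorname{lcm}$ denotes the least common multiple. An action of a finite group $G$ on an Abelian variety (over $\mathbb{C}$) $A$ is by automorphisms of $A$ as an algebraic variety (equivalently, by biholomorphisms); these are not required to fix the origin or to be group homomorphisms. The action is free if no non-identity element of $G$ has a fixed point in $A$. It "contains no translations" if no non-identity element of $G$ acts on $A$ as a translation $x\mapsto x+a$ with $a\in A$ (including $a=0$, so in particular the action is faithful). *)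

theory Defs
  imports "HOL-Analysis.Analysis" "HOL-Algebra.Group_Action"
begin

section \<open>Groups given by generators and relations\<close>

text \<open>
  A letter \<open>(x, True)\<close> stands for the generator \<open>x\<close> and \<open>(x, False)\<close> for its formal inverse;
  a word is a list of letters.
\<close>

inductive word_eq :: "('a \<times> bool) list set \<Rightarrow> ('a \<times> bool) list \<Rightarrow> ('a \<times> bool) list \<Rightarrow> bool"
  for R where
  word_refl: "word_eq R u u"
| word_sym: "word_eq R u v \<Longrightarrow> word_eq R v u"
| word_trans: "word_eq R u v \<Longrightarrow> word_eq R v w \<Longrightarrow> word_eq R u w"
| word_cong: "word_eq R u v \<Longrightarrow> word_eq R (p @ u @ q) (p @ v @ q)"
| word_cancel: "word_eq R [(x, b), (x, \<not> b)] []"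
| word_relator: "w \<in> R \<Longrightarrow> word_eq R w []"

definition word_rel :: "('a \<times> bool) list set \<Rightarrow> (('a \<times> bool) list \<times> ('a \<times> bool) list) set"
  where "word_rel R = {(u, v). word_eq R u v}"

definition presented_group :: "('a \<times> bool) list set \<Rightarrow> ('a \<times> bool) list set monoid"
  where "presented_group R =
    \<lparr> carrier = UNIV // word_rel R,
      monoid.mult = (\<lambda>U V. \<Union>u\<in>U. \<Union>v\<in>V. word_rel R `` {u @ v}),
      one = word_rel R `` {[]} \<rparr>"

lemma equiv_word_rel: "equiv UNIV (word_rel R)"
  by (rule equivI)
    (auto simp: word_rel_def refl_on_def sym_def trans_def
      intro: word_refl word_sym word_trans)

lemma word_eq_append:
  assumes "word_eq R u u'" and "word_eq R v v'"
  shows "word_eq R (u @ v) (u' @ v')"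
  using word_cong[OF assms(1), of "[]" v] word_cong[OF assms(2), of u' "[]"]
  by (auto intro: word_trans)

lemma presented_group_mult_class:
  "(word_rel R `` {u}) \<otimes>\<^bsub>presented_group R\<^esub> (word_rel R `` {v}) = word_rel R `` {u @ v}"
  unfolding presented_group_def word_rel_def
  by (auto intro: word_refl word_trans word_eq_append)

lemma word_eq_inverse: "word_eq R (rev (map (\<lambda>(x, b). (x, \<not> b)) w) @ w) []"
proof (induction w)
  case Nil
  show ?case by (simp add: word_refl)
next
  case (Cons l w)
  obtain x b where l: "l = (x, b)" by force
  let ?w = "rev (map (\<lambda>(x, b). (x, \<not> b)) w)"
  have "word_eq R (?w @ [(x, \<not> b), (x, \<not> \<not> b)] @ w) (?w @ [] @ w)"
    by (intro word_cong word_cancel)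
  with Cons.IH show ?case
    by (auto simp: l intro: word_trans)
qed

lemma group_presented_group: "group (presented_group R)"
proof -
  have car: "\<exists>u. U = word_rel R `` {u}" if "U \<in> carrier (presented_group R)" for U
    using that by (auto simp: presented_group_def elim: quotientE)
  have cl: "word_rel R `` {u} \<in> carrier (presented_group R)" for u
    by (auto simp: presented_group_def intro: quotientI)
  have one: "\<one>\<^bsub>presented_group R\<^esub> = word_rel R `` {[]}"
    by (simp add: presented_group_def)
  show ?thesis
  proof (rule groupI)
    fix U assume "U \<in> carrier (presented_group R)"
    then obtain u where u: "U = word_rel R `` {u}" using car by blast
    have "word_rel R `` {rev (map (\<lambda>(x, b). (x, \<not> b)) u) @ u} = word_rel R `` {[]}"
      using word_eq_inverse[of R u]
      by (intro equiv_class_eq[OF equiv_word_rel]) (simp add: word_rel_def)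
    then show "\<exists>V\<in>carrier (presented_group R). V \<otimes>\<^bsub>presented_group R\<^esub> U = \<one>\<^bsub>presented_group R\<^esub>"
      using cl u by (metis one presented_group_mult_class)
  qed (auto dest!: car simp: presented_group_mult_class one cl)
qed

datatype dihedral_gen = Rot | Ref

definition dihedral_group :: "nat \<Rightarrow> (dihedral_gen \<times> bool) list set monoid"
  where "dihedral_group k =
    (let r = (Rot, True); s = (Ref, True)
     in presented_group {replicate k r, [s, s], [r, s, r, s]})"


section \<open>Complex tori and Abelian varieties\<close>

definition lattice_in :: "(complex ^ 'g) set \<Rightarrow> bool"
  where "lattice_in \<Lambda> \<longleftrightarrow>
    0 \<in> \<Lambda> \<and> (\<forall>x\<in>\<Lambda>. \<forall>y\<in>\<Lambda>. x - y \<in> \<Lambda>) \<and> discrete \<Lambda> \<and> real_vector.span \<Lambda> = UNIV"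

definition torus_proj :: "(complex ^ 'g) set \<Rightarrow> complex ^ 'g \<Rightarrow> (complex ^ 'g) set"
  where "torus_proj \<Lambda> x = (+) x ` \<Lambda>"

definition torus :: "(complex ^ 'g) set \<Rightarrow> (complex ^ 'g) set set"
  where "torus \<Lambda> = range (torus_proj \<Lambda>)"

text \<open>
  A complex Abelian variety of dimension \<open>CARD('g)\<close> is a complex torus \<open>\<complex>\<^sup>g / \<Lambda>\<close> that admits a
  polarization, given as usual by a positive definite Hermitian form on \<open>\<complex>\<^sup>g\<close> whose imaginary
  part is integral on \<open>\<Lambda>\<close>.
\<close>

definition polarization :: "(complex ^ 'g) set \<Rightarrow> (complex ^ 'g \<Rightarrow> complex ^ 'g \<Rightarrow> complex) \<Rightarrow> bool"
  where "polarization \<Lambda> H \<longleftrightarrow>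
    (\<forall>y. Vector_Spaces.linear (*s) (*) (\<lambda>x. H x y)) \<and>
    (\<forall>x y. H y x = cnj (H x y)) \<and>
    (\<forall>x. x \<noteq> 0 \<longrightarrow> Re (H x x) > 0) \<and>
    (\<forall>x\<in>\<Lambda>. \<forall>y\<in>\<Lambda>. Im (H x y) \<in> \<int>)"

definition abelian_variety :: "(complex ^ 'g) set \<Rightarrow> bool"
  where "abelian_variety \<Lambda> \<longleftrightarrow> lattice_in \<Lambda> \<and> (\<exists>H. polarization \<Lambda> H)"

definition holomorphic_map_on ::
    "(complex ^ 'g \<Rightarrow> complex ^ 'h) \<Rightarrow> (complex ^ 'g) set \<Rightarrow> bool"
  where "holomorphic_map_on f U \<longleftrightarrow>
    (\<forall>x\<in>U. \<exists>D. (f has_derivative D) (at x) \<and> Vector_Spaces.linear (*s) (*s) D)"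

text \<open>
  The charts of \<open>\<complex>\<^sup>g / \<Lambda>\<close> are the local inverses of the projection, so a self-map of the torus
  is holomorphic iff locally it is induced by a holomorphic map between open subsets of \<open>\<complex>\<^sup>g\<close>.
\<close>

definition torus_holomorphic ::
    "(complex ^ 'g) set \<Rightarrow> ((complex ^ 'g) set \<Rightarrow> (complex ^ 'g) set) \<Rightarrow> bool"
  where "torus_holomorphic \<Lambda> F \<longleftrightarrow>
    (\<forall>x. \<exists>U f. open U \<and> x \<in> U \<and> holomorphic_map_on f U \<and>
      (\<forall>u\<in>U. F (torus_proj \<Lambda> u) = torus_proj \<Lambda> (f u)))"

definition torus_automorphism ::
    "(complex ^ 'g) set \<Rightarrow> ((complex ^ 'g) set \<Rightarrow> (complex ^ 'g) set) \<Rightarrow> bool"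
  where "torus_automorphism \<Lambda> F \<longleftrightarrow>
    bij_betw F (torus \<Lambda>) (torus \<Lambda>) \<and>
    torus_holomorphic \<Lambda> F \<and> torus_holomorphic \<Lambda> (inv_into (torus \<Lambda>) F)"

definition torus_translation ::
    "(complex ^ 'g) set \<Rightarrow> ((complex ^ 'g) set \<Rightarrow> (complex ^ 'g) set) \<Rightarrow> bool"
  where "torus_translation \<Lambda> F \<longleftrightarrow>
    (\<exists>a. \<forall>x. F (torus_proj \<Lambda> x) = torus_proj \<Lambda> (x + a))"


section \<open>Group actions on complex tori\<close>

definition torus_action ::
    "('a, 'b) monoid_scheme \<Rightarrow> (complex ^ 'g) set \<Rightarrow> ('a \<Rightarrow> (complex ^ 'g) set \<Rightarrow> (complex ^ 'g) set) \<Rightarrow> bool"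
  where "torus_action G \<Lambda> \<phi> \<longleftrightarrow>
    group_action G (torus \<Lambda>) \<phi> \<and> (\<forall>g\<in>carrier G. torus_automorphism \<Lambda> (\<phi> g))"

definition free_action ::
    "('a, 'b) monoid_scheme \<Rightarrow> 'x set \<Rightarrow> ('a \<Rightarrow> 'x \<Rightarrow> 'x) \<Rightarrow> bool"
  where "free_action G E \<phi> \<longleftrightarrow> (\<forall>g\<in>carrier G - {\<one>\<^bsub>G\<^esub>}. \<forall>x\<in>E. \<phi> g x \<noteq> x)"

definition contains_no_translations ::
    "('a, 'b) monoid_scheme \<Rightarrow> (complex ^ 'g) set \<Rightarrow> ('a \<Rightarrow> (complex ^ 'g) set \<Rightarrow> (complex ^ 'g) set) \<Rightarrow> bool"
  where "contains_no_translations G \<Lambda> \<phi> \<longleftrightarrow>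
    (\<forall>g\<in>carrier G - {\<one>\<^bsub>G\<^esub>}. \<not> torus_translation \<Lambda> (\<phi> g))"

end

theory Submission imports Defs
begin

text \<open>
  Let \<open>N = lcm 4 n\<close>, \<open>M = N / 2\<close> (an even number), \<open>E = \<complex> / \<int>[\<i>]\<close> and \<open>w = (1 + \<i>) / 2\<close>. Since
  \<open>D\<^sub>n\<close> embeds into \<open>D\<^sub>N\<close>, it is enough to let \<open>D\<^sub>N\<close> act on \<open>E\<^sup>M / \<langle>(w, \<dots>, w)\<rangle> \<times> E\<close>. Extend the
  coordinates \<open>x\<^sub>0, \<dots>, x\<^bsub>M-1\<^esub>\<close> to all integer indices by \<open>x\<^bsub>i+M\<^esub> = - x\<^sub>i\<close>, and put
  \<open>r (x, z) = ((x\<^bsub>i-1\<^esub>)\<^sub>i, z + 1/N)\<close> and \<open>s (x, z) = ((x\<^bsub>-i\<^esub> + a\<^sub>i)\<^sub>i, - z)\<close>,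
  where \<open>a\<^sub>i\<close> is \<open>1/2\<close> for even \<open>i\<close> and \<open>\<i>/2\<close> for odd \<open>i\<close>. The rotations are free because of the
  last coordinate. The square of \<open>r s\<close> translates all \<open>x\<^sub>i\<close> by \<open>1/2 + \<i>/2 = w\<close>, which is trivial in
  the quotient, and this nonzero class keeps \<open>r s\<close> from having fixed points; for \<open>s\<close> it is enough
  that \<open>a\<^sub>0\<close> is neither \<open>0\<close> nor \<open>w\<close>. The parity of \<open>M\<close> makes \<open>a\<close> compatible with the extension
  of the coordinates.
\<close>

section \<open>Words in the dihedral group\<close>

definition dihedral_relators :: "nat \<Rightarrow> (dihedral_gen \<times> bool) list set" where
  "dihedral_relators n = {replicate n (Rot, True), [(Ref, True), (Ref, True)],
    [(Rot, True), (Ref, True), (Rot, True), (Ref, True)]}"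

lemma dihedral_group_eq: "dihedral_group n = presented_group (dihedral_relators n)"
  by (simp add: dihedral_group_def dihedral_relators_def Let_def)

lemma word_eq_Cons: "word_eq R u v \<Longrightarrow> word_eq R (l # u) (l # v)"
  using word_cong[of R u v "[l]" "[]"] by simp

lemma word_eq_append_left: "word_eq R u v \<Longrightarrow> word_eq R (p @ u) (p @ v)"
  using word_cong[of R u v p "[]"] by simp

lemma word_eq_append_right: "word_eq R u v \<Longrightarrow> word_eq R (u @ q) (v @ q)"
  using word_cong[of R u v "[]" q] by simp

context
  fixes n :: nat and R
  assumes n: "n \<ge> 1"
  defines "R \<equiv> dihedral_relators n"
begin

lemma word_rot_power: "word_eq R (replicate n (Rot, True)) []"
  by (rule word_relator) (simp add: R_def dihedral_relators_def)

lemma word_ref_ref: "word_eq R [(Ref, True), (Ref, True)] []"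
  by (rule word_relator) (simp add: R_def dihedral_relators_def)

lemma word_rot_ref_rot_ref:
  "word_eq R [(Rot, True), (Ref, True), (Rot, True), (Ref, True)] []"
  by (rule word_relator) (simp add: R_def dihedral_relators_def)

lemma word_rot_power_mult: "word_eq R (replicate (n * k) (Rot, True)) []"
proof (induction k)
  case (Suc k)
  show ?case
    using word_eq_append[OF word_rot_power Suc.IH] by (simp add: replicate_add)
qed (simp add: word_refl)

lemma word_rot_inverse: "word_eq R [(Rot, False)] (replicate (n - 1) (Rot, True))"
proof -
  have "word_eq R ([(Rot, False)] @ replicate n (Rot, True)) ([(Rot, False)] @ [])"
    by (rule word_eq_append_left[OF word_rot_power])
  moreover have "word_eq R ([(Rot, False), (Rot, \<not> False)] @ replicate (n - 1) (Rot, True))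
      ([] @ replicate (n - 1) (Rot, True))"
    by (rule word_eq_append_right[OF word_cancel])
  moreover have "replicate n (Rot, True) = (Rot, True) # replicate (n - 1) (Rot, True)"
    using n by (cases n) auto
  ultimately show ?thesis
    by (auto intro: word_sym word_trans)
qed

lemma word_ref_inverse: "word_eq R [(Ref, False)] [(Ref, True)]"
proof -
  have "word_eq R ([(Ref, False)] @ [(Ref, True), (Ref, True)]) ([(Ref, False)] @ [])"
    by (rule word_eq_append_left[OF word_ref_ref])
  moreover have "word_eq R ([(Ref, False), (Ref, \<not> False)] @ [(Ref, True)]) ([] @ [(Ref, True)])"
    by (rule word_eq_append_right[OF word_cancel])
  ultimately show ?thesis
    by (auto intro: word_sym word_trans)
qed

text \<open>Padding \<open>s r\<close> with the trivial words \<open>r^n\<close> in front and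
  \<open>s s\<close> behind creates the factor \<open>r s r s\<close>, which cancels.\<close>

lemma word_ref_rot:
  "word_eq R [(Ref, True), (Rot, True)] (replicate (n - 1) (Rot, True) @ [(Ref, True)])"
proof -
  let ?r = "(Rot, True)" and ?s = "(Ref, True)"
  have rep: "replicate n ?r = replicate (n - 1) ?r @ [?r]"
    using n by (cases n) (auto simp: replicate_append_same)
  have "word_eq R ([] @ [?s, ?r]) (replicate n ?r @ [?s, ?r])"
    by (intro word_eq_append_right word_sym[OF word_rot_power])
  moreover have "word_eq R ((replicate n ?r @ [?s, ?r]) @ []) ((replicate n ?r @ [?s, ?r]) @ [?s, ?s])"
    by (intro word_eq_append_left word_sym[OF word_ref_ref])
  moreover have "word_eq R (replicate (n - 1) ?r @ [?r, ?s, ?r, ?s] @ [?s])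
      (replicate (n - 1) ?r @ [] @ [?s])"
    by (intro word_cong word_rot_ref_rot_ref)
  ultimately show ?thesis
    unfolding rep by (auto intro: word_trans)
qed

lemma word_ref_rot_power:
  "word_eq R ((Ref, True) # replicate j (Rot, True))
    (replicate ((n - 1) * j) (Rot, True) @ [(Ref, True)])"
proof (induction j)
  case (Suc j)
  let ?r = "(Rot, True)" and ?s = "(Ref, True)"
  have "word_eq R ([?s, ?r] @ replicate j ?r) ((replicate (n - 1) ?r @ [?s]) @ replicate j ?r)"
    by (rule word_eq_append_right[OF word_ref_rot])
  moreover have "word_eq R (replicate (n - 1) ?r @ (?s # replicate j ?r))
      (replicate (n - 1) ?r @ (replicate ((n - 1) * j) ?r @ [?s]))"
    by (rule word_eq_append_left[OF Suc.IH])
  ultimately show ?case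
    by (auto simp: replicate_add intro: word_trans)
qed (simp add: word_refl)

text \<open>Inverse letters are replaced by positive ones, and an \<open>s\<close> on the left is
  pushed through the powers of \<open>r\<close>, where the exponent \<open>-j\<close> appears as the
  natural number \<open>(n - 1) * j\<close>.\<close>

lemma word_normal_form:
  "\<exists>j b. word_eq R w (replicate j (Rot, True) @ (if b then [(Ref, True)] else []))"
proof (induction w)
  case Nil
  show ?case
    by (rule exI[of _ 0], rule exI[of _ False]) (simp add: word_refl)
next
  case (Cons l w)
  let ?r = "(Rot, True)" and ?s = "(Ref, True)"
  let ?t = "\<lambda>b. if b then [?s] else []"
  from Cons.IH obtain j b where w: "word_eq R w (replicate j ?r @ ?t b)" by blast
  consider "l = ?r" | "l = (Rot, False)" | c where "l = (Ref, c)"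
    by (cases l; cases "fst l"; cases "snd l") auto
  then show ?case
  proof cases
    case 1
    then show ?thesis
      using word_eq_Cons[OF w, of l] by (intro exI[of _ "Suc j"] exI[of _ b]) simp
  next
    case 2
    then have "word_eq R (l # w) (replicate (n - 1 + j) ?r @ ?t b)"
      using word_eq_append[OF word_rot_inverse w] by (simp add: replicate_add)
    then show ?thesis by blast
  next
    case 3
    have "word_eq R [l] [?s]"
      using word_ref_inverse 3 by (cases c) (auto intro: word_refl)
    from word_eq_append[OF this w]
    have "word_eq R (l # w) ((?s # replicate j ?r) @ ?t b)" by simp
    moreover have "word_eq R ((?s # replicate j ?r) @ ?t b)
        ((replicate ((n - 1) * j) ?r @ [?s]) @ ?t b)"
      by (rule word_eq_append_right[OF word_ref_rot_power])
    moreover have "word_eq R ([?s] @ ?t b) (?t (\<not> b))"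
      using word_ref_ref by (auto intro: word_refl)
    then have "word_eq R ((replicate ((n - 1) * j) ?r @ [?s]) @ ?t b)
        (replicate ((n - 1) * j) ?r @ ?t (\<not> b))"
      using word_eq_append_left by (metis append.assoc)
    ultimately show ?thesis by (blast intro: word_trans)
  qed
qed

end

section \<open>Actions on tori induced by affine maps\<close>

text \<open>\<open>T j b\<close> lifts \<open>r\<^sup>j\<close> (for \<open>b = False\<close>) or \<open>r\<^sup>j s\<close> (for \<open>b = True\<close>) to \<open>\<complex>\<^sup>g\<close>.\<close>

locale torus_dihedral =
  fixes \<Lambda> :: "(complex ^ 'g::finite) set" and n :: nat and T :: "int \<Rightarrow> bool \<Rightarrow> complex ^ 'g \<Rightarrow> complex ^ 'g"
  assumes n: "n \<ge> 1"
    and zero: "0 \<in> \<Lambda>"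
    and diff: "x \<in> \<Lambda> \<Longrightarrow> y \<in> \<Lambda> \<Longrightarrow> x - y \<in> \<Lambda>"
    and holo: "holomorphic_map_on (T j b) UNIV"
    and resp: "x - y \<in> \<Lambda> \<Longrightarrow> T j b x - T j b y \<in> \<Lambda>"
    and comp: "T j b (T k c x) - T (if b then j - k else j + k) (b \<noteq> c) x \<in> \<Lambda>"
    and T_zero: "T 0 False x - x \<in> \<Lambda>"
    and T_period: "T (int n) False x - x \<in> \<Lambda>"
begin

section \<open>Congruence modulo the lattice, and words acting on the covering space\<close>

definition lcong (infix "\<doteq>" 50) where "x \<doteq> y \<longleftrightarrow> x - y \<in> \<Lambda>"

lemma lcong_refl [simp]: "x \<doteq> x"
  by (simp add: lcong_def zero)

lemma lcong_sym: "x \<doteq> y \<Longrightarrow> y \<doteq> x"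
  using diff[OF zero, of "x - y"] by (simp add: lcong_def)

lemma lcong_trans [trans]: "x \<doteq> y \<Longrightarrow> y \<doteq> z \<Longrightarrow> x \<doteq> z"
  using diff[of "x - y" "z - y"] lcong_sym[of y z] by (simp add: lcong_def)

lemma torus_proj_eq_iff: "torus_proj \<Lambda> x = torus_proj \<Lambda> y \<longleftrightarrow> x \<doteq> y"
proof
  assume "torus_proj \<Lambda> x = torus_proj \<Lambda> y"
  moreover have "x \<in> torus_proj \<Lambda> x"
    using zero by (force simp: torus_proj_def)
  ultimately show "x \<doteq> y"
    by (auto simp: torus_proj_def lcong_def)
next
  have *: "torus_proj \<Lambda> x \<subseteq> torus_proj \<Lambda> y" if "x \<doteq> y" for x y
  proof
    fix v assume "v \<in> torus_proj \<Lambda> x"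
    then have "v \<doteq> x" by (auto simp: torus_proj_def lcong_def)
    with that have "v \<doteq> y" by (blast intro: lcong_trans)
    then show "v \<in> torus_proj \<Lambda> y"
      by (auto simp: torus_proj_def lcong_def image_iff intro!: bexI[of _ "v - y"])
  qed
  assume "x \<doteq> y"
  then show "torus_proj \<Lambda> x = torus_proj \<Lambda> y"
    using * lcong_sym by blast
qed

text \<open>Both signs of \<open>Ref\<close> get the same map because \<open>T 0 True\<close> is an
  involution modulo \<open>\<Lambda>\<close>.\<close>

fun letter_act :: "dihedral_gen \<times> bool \<Rightarrow> complex ^ 'g \<Rightarrow> complex ^ 'g" where
  "letter_act (Rot, b) = T (if b then 1 else - 1) False"
| "letter_act (Ref, b) = T 0 True"

definition word_act :: "(dihedral_gen \<times> bool) list \<Rightarrow> complex ^ 'g \<Rightarrow> complex ^ 'g" where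
  "word_act = foldr letter_act"

lemma word_act_simps [simp]:
  "word_act [] x = x" "word_act (l # u) x = letter_act l (word_act u x)"
  "word_act (u @ v) x = word_act u (word_act v x)"
  by (simp_all add: word_act_def)

lemma T_lcong: "x \<doteq> y \<Longrightarrow> T j b x \<doteq> T j b y"
  using resp by (simp add: lcong_def)

text \<open>The family \<open>T j b\<close> is closed under composition up to
  \<open>\<Lambda>\<close>, so every word inherits from a single member its compatibility with
  \<open>\<Lambda>\<close> and a holomorphic lift.\<close>

lemma word_act_T: "\<exists>j b. \<forall>x. word_act w x \<doteq> T j b x"
proof (induction w)
  case Nil
  show ?case
    using T_zero by (auto simp: lcong_def intro: lcong_sym[unfolded lcong_def])
next
  case (Cons l w)
  then obtain j b where w: "\<And>x. word_act w x \<doteq> T j b x" by blast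
  obtain k c where l: "letter_act l = T k c"
    by (cases l rule: letter_act.cases) auto
  have "word_act (l # w) x \<doteq> T (if c then k - j else k + j) (c \<noteq> b) x" for x
    using lcong_trans[OF T_lcong[OF w] comp[folded lcong_def]] by (simp add: l)
  then show ?case by blast
qed

lemma word_act_lcong: "x \<doteq> y \<Longrightarrow> word_act w x \<doteq> word_act w y"
  using word_act_T[of w] T_lcong by (meson lcong_sym lcong_trans)

lemma word_act_rot_power: "word_act (replicate k (Rot, True)) x \<doteq> T (int k) False x"
proof (induction k)
  case 0
  show ?case using T_zero lcong_sym by (simp add: lcong_def)
next
  case (Suc k)
  show ?case
    using lcong_trans[OF T_lcong[OF Suc.IH] comp[folded lcong_def], of 1 False] by simp
qed

lemma word_act_ref_power: "word_act (replicate k (Rot, True) @ [(Ref, True)]) x \<doteq> T (int k) True x"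
  using lcong_trans[OF word_act_rot_power comp[folded lcong_def], of k 0 True] by simp

lemma T_inverse: "T j b (T (if b then j else - j) b x) \<doteq> x"
  using comp[of j b "if b then j else - j" b x] T_zero
  by (cases b) (auto simp flip: lcong_def intro: lcong_trans)

text \<open>By \<open>T_inverse\<close> every \<open>T j True\<close> is an involution modulo
  \<open>\<Lambda>\<close>: \<open>j = 0\<close> settles \<open>s s\<close>, and
  \<open>j = 1\<close> settles \<open>r s r s\<close>. The power \<open>r^n\<close> is settled by
  \<open>T_period\<close>.\<close>

lemma word_act_relator:
  assumes "w \<in> dihedral_relators n"
  shows "word_act w x \<doteq> x"
proof -
  have ref: "T 0 True (T 0 True x) \<doteq> x" for x
    using T_inverse[of 0 True] by simp
  have rr: "T 1 False (T 0 True x) \<doteq> T 1 True x" for x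
    using comp[of 1 False 0 True x] by (simp add: lcong_def)
  have "T 1 True (T 1 True x) \<doteq> x" for x
    using T_inverse[of 1 True] by simp
  then have "T 1 False (T 0 True (T 1 False (T 0 True x))) \<doteq> x"
    using rr T_lcong by (meson lcong_trans)
  with assms ref lcong_trans[OF word_act_rot_power T_period[folded lcong_def]]
  show ?thesis by (auto simp: dihedral_relators_def)
qed

lemma word_act_word_eq: "word_eq (dihedral_relators n) u v \<Longrightarrow> word_act u x \<doteq> word_act v x"
proof (induction arbitrary: x rule: word_eq.induct)
  case (word_cong u v p q)
  then show ?case by (simp add: word_act_lcong)
next
  case (word_cancel g b)
  have "T 0 True (T 0 True x) \<doteq> x" "T 1 False (T (-1) False x) \<doteq> x" "T (-1) False (T 1 False x) \<doteq> x"
    using T_inverse[of 0 True] T_inverse[of 1 False] T_inverse[of "- 1" False] by simp_all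
  then show ?case by (cases g) auto
next
  case (word_relator w)
  then show ?case by (simp add: word_act_relator)
qed (auto intro: lcong_sym lcong_trans)

section \<open>Descent of words to self-maps of the torus\<close>

text \<open>The choice of representative is harmless by \<open>word_act_lcong\<close>. Restricting
  to \<open>torus \<Lambda>\<close> makes the map extensional, as membership in
  \<open>BijGroup\<close> demands.\<close>

definition word_map :: "(dihedral_gen \<times> bool) list \<Rightarrow> (complex ^ 'g) set \<Rightarrow> (complex ^ 'g) set" where
  "word_map w = (\<lambda>X \<in> torus \<Lambda>. torus_proj \<Lambda> (word_act w (SOME x. X = torus_proj \<Lambda> x)))"

lemma word_map_proj [simp]: "word_map w (torus_proj \<Lambda> x) = torus_proj \<Lambda> (word_act w x)"
proof -
  have "torus_proj \<Lambda> x = torus_proj \<Lambda> (SOME y. torus_proj \<Lambda> x = torus_proj \<Lambda> y)"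
    by (rule someI) simp
  then show ?thesis
    by (auto simp: word_map_def torus_def torus_proj_eq_iff intro: word_act_lcong lcong_sym)
qed

lemma word_map_extensional: "word_map w \<in> extensional (torus \<Lambda>)"
  by (simp add: word_map_def)

lemma word_map_eqI:
  assumes "F \<in> extensional (torus \<Lambda>)"
    and "\<And>x. F (torus_proj \<Lambda> x) = torus_proj \<Lambda> (word_act w x)"
  shows "word_map w = F"
proof (rule extensionalityI[OF word_map_extensional assms(1)])
  show "word_map w X = F X" if "X \<in> torus \<Lambda>" for X
    using that assms(2) by (auto simp: torus_def)
qed

lemma word_map_append: "word_map (u @ v) = compose (torus \<Lambda>) (word_map u) (word_map v)"
  by (rule word_map_eqI) (auto simp: compose_def torus_def)

lemma word_map_word_eq:
  assumes "word_eq (dihedral_relators n) u v"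
  shows "word_map u = word_map v"
  by (rule word_map_eqI)
    (simp_all add: word_map_extensional torus_proj_eq_iff word_act_word_eq[OF word_sym[OF assms]])

lemma word_map_Nil: "word_map [] = (\<lambda>X \<in> torus \<Lambda>. X)"
  by (rule word_map_eqI) (auto simp: torus_def)

abbreviation "inv_word w \<equiv> rev (map (\<lambda>(x, b). (x, \<not> b)) w)"

lemma inv_word_inv_word: "inv_word (inv_word w) = w"
  by (induction w) auto

lemma word_map_inverse:
  assumes "X \<in> torus \<Lambda>"
  shows "word_map (inv_word w) (word_map w X) = X"
    and "word_map w (word_map (inv_word w) X) = X"
proof -
  have "word_map (inv_word w) (word_map w X) = X" for w
  proof -
    have "word_map (inv_word w @ w) X = word_map [] X"
      using word_map_word_eq[OF word_eq_inverse] by metis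
    with assms show ?thesis by (simp add: word_map_append word_map_Nil compose_eq)
  qed
  from this this[of "inv_word w"] show "word_map (inv_word w) (word_map w X) = X"
    and "word_map w (word_map (inv_word w) X) = X"
    unfolding inv_word_inv_word .
qed

lemma word_map_torus: "X \<in> torus \<Lambda> \<Longrightarrow> word_map w X \<in> torus \<Lambda>"
  by (auto simp: torus_def)

lemma bij_word_map: "bij_betw (word_map w) (torus \<Lambda>) (torus \<Lambda>)"
  by (rule bij_betw_byWitness[of _ "word_map (inv_word w)"])
    (auto simp: word_map_inverse word_map_torus)

text \<open>One global lift \<open>T j b\<close> serves at every point. Agreement with
  \<open>F\<close> is asked on the torus only, so that the lemma also applies to
  \<open>inv_into\<close>.\<close>

lemma word_map_holomorphic:
  assumes "\<And>X. X \<in> torus \<Lambda> \<Longrightarrow> F X = word_map w X"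
  shows "torus_holomorphic \<Lambda> F"
proof -
  obtain j b where "\<And>x. word_act w x \<doteq> T j b x" using word_act_T by blast
  then have "F (torus_proj \<Lambda> x) = torus_proj \<Lambda> (T j b x)" for x
    using assms[of "torus_proj \<Lambda> x"] by (simp add: torus_proj_eq_iff[symmetric]) (simp add: torus_def)
  with holo show ?thesis
    unfolding torus_holomorphic_def by (meson UNIV_I open_UNIV)
qed

lemma word_map_automorphism: "torus_automorphism \<Lambda> (word_map w)"
proof -
  have "inv_into (torus \<Lambda>) (word_map w) X = word_map (inv_word w) X" if "X \<in> torus \<Lambda>" for X
    using that bij_word_map[of w]
    by (intro inv_into_f_eq) (auto simp: word_map_inverse word_map_torus bij_betw_def)
  then show ?thesis
    unfolding torus_automorphism_def
    using bij_word_map word_map_holomorphic by blast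
qed

section \<open>The induced action of the dihedral group\<close>

definition dihedral_act where
  "dihedral_act U = word_map (SOME u. u \<in> U)"

abbreviation "wclass u \<equiv> word_rel (dihedral_relators n) `` {u}"

lemma dihedral_act_class: "dihedral_act (wclass u) = word_map u"
proof -
  have "u \<in> wclass u" by (simp add: word_rel_def word_refl)
  then have "(SOME v. v \<in> wclass u) \<in> wclass u" by (rule someI)
  then have "word_eq (dihedral_relators n) u (SOME v. v \<in> wclass u)"
    by (simp add: word_rel_def)
  then show ?thesis
    using word_map_word_eq by (simp add: dihedral_act_def)
qed

lemma carrier_dihedral: "U \<in> carrier (dihedral_group n) \<Longrightarrow> \<exists>u. U = wclass u"
  by (auto simp: dihedral_group_eq presented_group_def elim: quotientE)

lemma dihedral_torus_action: "torus_action (dihedral_group n) \<Lambda> dihedral_act"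
proof -
  have Bij: "word_map u \<in> Bij (torus \<Lambda>)" for u
    using bij_word_map by (auto simp: Bij_def word_map_def)
  have "dihedral_act \<in> hom (dihedral_group n) (BijGroup (torus \<Lambda>))"
  proof (rule homI)
    fix U assume "U \<in> carrier (dihedral_group n)"
    then obtain u where "U = wclass u" using carrier_dihedral by blast
    with Bij show "dihedral_act U \<in> carrier (BijGroup (torus \<Lambda>))"
      by (simp add: dihedral_act_class BijGroup_def)
  next
    fix U V assume "U \<in> carrier (dihedral_group n)" "V \<in> carrier (dihedral_group n)"
    then obtain u v where uv: "U = wclass u" "V = wclass v" using carrier_dihedral by meson
    with Bij show "dihedral_act (U \<otimes>\<^bsub>dihedral_group n\<^esub> V) =
        dihedral_act U \<otimes>\<^bsub>BijGroup (torus \<Lambda>)\<^esub> dihedral_act V"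
      by (simp add: dihedral_act_class presented_group_mult_class dihedral_group_eq
          word_map_append BijGroup_def)
  qed
  then have "group_action (dihedral_group n) (torus \<Lambda>) dihedral_act"
    by (simp add: group_action_def group_hom_def group_hom_axioms_def group_BijGroup
        dihedral_group_eq group_presented_group)
  moreover have "torus_automorphism \<Lambda> (dihedral_act U)" if "U \<in> carrier (dihedral_group n)" for U
    using carrier_dihedral[OF that] by (auto simp: dihedral_act_class word_map_automorphism)
  ultimately show ?thesis by (simp add: torus_action_def)
qed

text \<open>In the normal form of a nontrivial element a missing \<open>s\<close> forces
  \<open>n\<close> not to divide \<open>j\<close>, since \<open>r^n\<close> is trivial. Freeness and
  absence of translations thus become statements about the lifts \<open>T j b\<close>.\<close>

lemma nontrivial_dihedral_act:
  assumes "U \<in> carrier (dihedral_group n) - {\<one>\<^bsub>dihedral_group n\<^esub>}"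
  shows "\<exists>b j. (b \<or> \<not> int n dvd j) \<and>
    (\<forall>x. dihedral_act U (torus_proj \<Lambda> x) = torus_proj \<Lambda> (T j b x))"
proof -
  let ?t = "\<lambda>b. if b then [(Ref, True)] else []"
  obtain u where u: "U = wclass u" using assms carrier_dihedral by blast
  obtain j b where nf: "word_eq (dihedral_relators n) u (replicate j (Rot, True) @ ?t b)"
    using word_normal_form[OF n] by blast
  have "\<not> word_eq (dihedral_relators n) u []"
  proof
    assume "word_eq (dihedral_relators n) u []"
    then have "wclass u = wclass []"
      by (intro equiv_class_eq[OF equiv_word_rel]) (simp add: word_rel_def)
    with assms u show False by (simp add: dihedral_group_eq presented_group_def)
  qed
  moreover have "word_eq (dihedral_relators n) u []" if b: "\<not> b" and "n dvd j"
  proof -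
    from \<open>n dvd j\<close> obtain k where "j = n * k" by blast
    then show ?thesis
      using word_trans[OF nf] b word_rot_power_mult[OF n, of k] by simp
  qed
  ultimately have "b \<or> \<not> int n dvd int j" by auto
  moreover have "dihedral_act U (torus_proj \<Lambda> x) = torus_proj \<Lambda> (T (int j) b x)" for x
    unfolding u dihedral_act_class word_map_word_eq[OF nf] word_map_proj torus_proj_eq_iff
    using word_act_rot_power[of j x] word_act_ref_power[of j x] by (cases b) simp_all
  ultimately show ?thesis by (intro exI[of _ b] exI[of _ "int j"]) simp
qed

lemma dihedral_free_action:
  assumes "\<And>j b x. b \<or> \<not> int n dvd j \<Longrightarrow> T j b x - x \<notin> \<Lambda>"
  shows "free_action (dihedral_group n) (torus \<Lambda>) dihedral_act"
  unfolding free_action_def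
proof (intro ballI)
  fix U X
  assume U: "U \<in> carrier (dihedral_group n) - {\<one>\<^bsub>dihedral_group n\<^esub>}" and "X \<in> torus \<Lambda>"
  then obtain x where X: "X = torus_proj \<Lambda> x" by (auto simp: torus_def)
  obtain b j where "b \<or> \<not> int n dvd j"
    and "\<And>x. dihedral_act U (torus_proj \<Lambda> x) = torus_proj \<Lambda> (T j b x)"
    using nontrivial_dihedral_act[OF U] by metis
  with assms show "dihedral_act U X \<noteq> X"
    by (simp add: X torus_proj_eq_iff lcong_def)
qed

lemma dihedral_no_translations:
  assumes "\<And>j b a. b \<or> \<not> int n dvd j \<Longrightarrow> \<exists>x. T j b x - (x + a) \<notin> \<Lambda>"
  shows "contains_no_translations (dihedral_group n) \<Lambda> dihedral_act"
proof -
  have "\<not> torus_translation \<Lambda> (dihedral_act U)"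
    if U: "U \<in> carrier (dihedral_group n) - {\<one>\<^bsub>dihedral_group n\<^esub>}" for U
  proof -
    obtain b j where "b \<or> \<not> int n dvd j"
      and "\<And>x. dihedral_act U (torus_proj \<Lambda> x) = torus_proj \<Lambda> (T j b x)"
      using nontrivial_dihedral_act[OF U] by metis
    with assms show ?thesis
      by (simp add: torus_translation_def torus_proj_eq_iff lcong_def)
  qed
  then show ?thesis by (simp add: contains_no_translations_def)
qed

end

section \<open>The torus\<close>

definition gauss_int :: "complex set" where
  "gauss_int = {z. Re z \<in> \<int> \<and> Im z \<in> \<int>}"

lemma gauss_int_zero [simp]: "0 \<in> gauss_int"
  by (simp add: gauss_int_def)

lemma gauss_int_diff: "x \<in> gauss_int \<Longrightarrow> y \<in> gauss_int \<Longrightarrow> x - y \<in> gauss_int"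
  by (simp add: gauss_int_def)

lemma gauss_int_add: "x \<in> gauss_int \<Longrightarrow> y \<in> gauss_int \<Longrightarrow> x + y \<in> gauss_int"
  by (simp add: gauss_int_def)

lemma gauss_int_mult: "x \<in> gauss_int \<Longrightarrow> y \<in> gauss_int \<Longrightarrow> x * y \<in> gauss_int"
  by (simp add: gauss_int_def)

lemma gauss_int_cnj: "x \<in> gauss_int \<Longrightarrow> cnj x \<in> gauss_int"
  by (simp add: gauss_int_def)

lemma gauss_int_sum: "(\<And>i. i \<in> I \<Longrightarrow> h i \<in> gauss_int) \<Longrightarrow> sum h I \<in> gauss_int"
  by (induction I rule: infinite_finite_induct) (auto intro: gauss_int_add)

lemma norm_gauss_int:
  assumes "z \<in> gauss_int" "z \<noteq> 0"
  shows "norm z \<ge> 1"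
proof -
  have "\<bar>Re z\<bar> \<ge> 1 \<or> \<bar>Im z\<bar> \<ge> 1"
    using assms Ints_nonzero_abs_ge1 by (auto simp: gauss_int_def complex_eq_iff)
  then show ?thesis
    using abs_Re_le_cmod[of z] abs_Im_le_cmod[of z] by linarith
qed

lemma not_Ints_real:
  fixes x :: real
  assumes "0 < \<bar>x\<bar>" "\<bar>x\<bar> < 1"
  shows "x \<notin> \<int>"
  using assms Ints_nonzero_abs_ge1[of x] by auto

text \<open>
  \<open>f\<close> enumerates the coordinates; \<open>f M\<close> is the last one, on which the rotations act by translations.
\<close>

locale shift_torus =
  fixes M :: int and f :: "int \<Rightarrow> 'g::finite"
  assumes M_pos: "M > 0" and M_even: "even M" and bij_f: "bij_betw f {0..M} UNIV"
begin

section \<open>Antiperiodic extension of the coordinates\<close>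

definition index :: "'g \<Rightarrow> int" where "index = inv_into {0..M} f"

lemma index_f [simp]: "0 \<le> i \<Longrightarrow> i \<le> M \<Longrightarrow> index (f i) = i"
  using bij_f by (simp add: index_def bij_betw_def inv_into_f_f)

lemma f_index [simp]: "f (index p) = p"
  using bij_f by (simp add: index_def bij_betw_inv_into_right)

lemma index_range: "0 \<le> index p" "index p \<le> M"
  using bij_betw_inv_into[OF bij_f] by (auto simp: index_def bij_betw_def)

lemma index_less: "p \<noteq> f M \<Longrightarrow> index p < M"
  using index_range[of p] f_index[of p] by (cases "index p = M") auto

lemma f_neq [simp]: "0 \<le> i \<Longrightarrow> i < M \<Longrightarrow> f i \<noteq> f M"
  using index_f[of i] index_f[of M] M_pos by force

abbreviation sign :: "int \<Rightarrow> complex" where "sign q \<equiv> (if even q then 1 else - 1)"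

text \<open>Only indices below \<open>M\<close> occur on the right, so the last coordinate
  \<open>f M\<close> does not enter.\<close>

definition ext :: "complex ^ 'g \<Rightarrow> int \<Rightarrow> complex" where
  "ext x i = sign (i div M) * x $ f (i mod M)"

lemma ext_add: "ext (x + y) i = ext x i + ext y i"
  by (simp add: ext_def algebra_simps)

lemma ext_diff: "ext (x - y) i = ext x i - ext y i"
  by (simp add: ext_def algebra_simps)

lemma ext_scale: "ext (c *s x) i = c * ext x i"
  by (simp add: ext_def)

lemma ext_zero [simp]: "ext 0 i = 0"
  by (simp add: ext_def)

lemma ext_base: "0 \<le> i \<Longrightarrow> i < M \<Longrightarrow> ext x i = x $ f i"
  by (simp add: ext_def)

lemma ext_shift: "ext x (i + M) = - ext x i"
  using M_pos by (simp add: ext_def)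

lemma antiperiodic:
  fixes F :: "int \<Rightarrow> complex"
  assumes "\<And>i. F (i + M) = - F i"
  shows "F (r + M * q) = sign q * F r"
proof (induction q rule: int_induct[of _ 0])
  case base
  show ?case by simp
next
  case (step1 q)
  have "F (r + M * (q + 1)) = - F (r + M * q)"
    using assms[of "r + M * q"] by (simp add: distrib_left add.assoc)
  with step1.IH show ?case by simp
next
  case (step2 q)
  have "r + M * (q - 1) + M = r + M * q" by (simp add: right_diff_distrib)
  then have "F (r + M * q) = - F (r + M * (q - 1))"
    using assms[of "r + M * (q - 1)"] by metis
  then have "F (r + M * (q - 1)) = - F (r + M * q)" by simp
  with step2.IH show ?case by simp
qed

text \<open>An antiperiodic function is determined by its values on \<open>{0..<M}\<close>; this
  computes the extension of a vector given by a formula.\<close>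

lemma ext_eqI:
  assumes F: "\<And>i. F (i + M) = - F i"
    and "\<And>p. p \<noteq> f M \<Longrightarrow> y $ p = F (index p)"
  shows "ext y i = F i"
proof -
  have "0 \<le> i mod M" "i mod M < M" using M_pos by auto
  then have "ext y i = sign (i div M) * F (i mod M)"
    using assms(2)[of "f (i mod M)"] by (simp add: ext_def)
  also have "\<dots> = F i"
    using antiperiodic[of F, OF F, of "i mod M" "i div M"] by (simp add: mult.commute)
  finally show ?thesis .
qed

section \<open>The lattice and the lifted maps\<close>

definition w :: complex where "w = Complex (1/2) (1/2)"

definition a :: "int \<Rightarrow> complex" where "a i = (if even i then 1/2 else \<i>/2)"

text \<open>Since \<open>M\<close> is even, \<open>a\<close> is \<open>M\<close>-periodic, whereas
  extended coordinates are antiperiodic. Using \<open>ext \<alpha>\<close> in place of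
  \<open>a\<close> makes the formula for \<open>T\<close> exactly antiperiodic.\<close>

definition \<alpha> :: "complex ^ 'g" where "\<alpha> = (\<chi> p. a (index p))"

text \<open>The kernel of the projection to the quotient of \<open>E^M\<close> by
  \<open>(w, ..., w)\<close>, times \<open>E\<close>. Letting \<open>i\<close> run over all integers
  agrees with the sign changes of \<open>ext\<close>, since \<open>2 * w\<close> is
  Gaussian.\<close>

definition \<Lambda> :: "(complex ^ 'g) set" where
  "\<Lambda> = {x. x $ f M \<in> gauss_int \<and> (\<exists>c\<in>{0, w}. \<forall>i. ext x i - c \<in> gauss_int)}"

text \<open>Applying \<open>r^j\<close> substitutes \<open>i - j\<close> for \<open>i\<close>; after
  \<open>s\<close> this turns the reflected index \<open>- i\<close> into \<open>j - i\<close> and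
  the index of the shift into \<open>i - j\<close>.\<close>

definition T :: "int \<Rightarrow> bool \<Rightarrow> complex ^ 'g \<Rightarrow> complex ^ 'g" where
  "T j b x = (\<chi> p.
    if p = f M then (if b then - x $ p else x $ p) + of_int j / of_int (2 * M)
    else if b then ext x (j - index p) + ext \<alpha> (index p - j)
    else ext x (index p - j))"

text \<open>Reduction modulo the even number \<open>M\<close> keeps the parity, and a change of sign
  is invisible because \<open>2 * a i\<close> is Gaussian.\<close>

lemma ext_alpha: "ext \<alpha> i - a i \<in> gauss_int"
proof -
  have "even (i mod M) \<longleftrightarrow> even i"
    using M_even by (simp add: dvd_mod_iff)
  moreover have "0 \<le> i mod M" "i mod M < M" using M_pos by auto
  ultimately have "ext \<alpha> i = a i \<or> ext \<alpha> i = - a i"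
    by (auto simp: ext_def \<alpha>_def a_def)
  then show ?thesis by (elim disjE) (simp_all add: a_def gauss_int_def)
qed

lemma T_last [simp]: "T j b x $ f M = (if b then - x $ f M else x $ f M) + of_int j / of_int (2 * M)"
  by (simp add: T_def)

lemma ext_T:
  "ext (T j b x) i = (if b then ext x (j - i) + ext \<alpha> (i - j) else ext x (i - j))"
proof (rule ext_eqI)
  fix i
  show "(if b then ext x (j - (i + M)) + ext \<alpha> (i + M - j) else ext x (i + M - j)) =
    - (if b then ext x (j - i) + ext \<alpha> (i - j) else ext x (i - j))"
    using ext_shift[of x "j - (i + M)"] ext_shift[of \<alpha> "i - j"] ext_shift[of x "i - j"]
    by (simp add: algebra_simps)
qed (simp add: T_def)

lemma LambdaI:
  assumes "x $ f M \<in> gauss_int" "c \<in> {0, w}" "\<And>i. ext x i - c \<in> gauss_int"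
  shows "x \<in> \<Lambda>"
  using assms by (auto simp: \<Lambda>_def)

lemma Lambda_last: "x \<in> \<Lambda> \<Longrightarrow> x $ f M \<in> gauss_int"
  by (simp add: \<Lambda>_def)

lemma Lambda_ext:
  assumes "x \<in> \<Lambda>"
  obtains c where "c \<in> {0, w}" "\<And>i. ext x i - c \<in> gauss_int"
  using assms by (fastforce simp: \<Lambda>_def)

lemma Lambda_zero: "0 \<in> \<Lambda>"
  by (rule LambdaI[of _ 0]) auto

lemma two_w: "2 * w \<in> gauss_int"
  by (simp add: w_def gauss_int_def)

lemma Lambda_diff:
  assumes "x \<in> \<Lambda>" "y \<in> \<Lambda>"
  shows "x - y \<in> \<Lambda>"
proof -
  obtain c where c: "c \<in> {0, w}" "\<And>i. ext x i - c \<in> gauss_int"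
    using Lambda_ext[OF assms(1)] by blast
  obtain d where d: "d \<in> {0, w}" "\<And>i. ext y i - d \<in> gauss_int"
    using Lambda_ext[OF assms(2)] by blast
  define e where "e = (if c = d then 0 else w)"
  have "c - d - e \<in> gauss_int"
    using c(1) d(1) two_w by (auto simp: e_def gauss_int_def)
  then have "(ext x i - c) - (ext y i - d) + (c - d - e) \<in> gauss_int" for i
    by (rule gauss_int_add[OF gauss_int_diff[OF c(2) d(2)]])
  moreover have "(x - y) $ f M \<in> gauss_int"
    using assms by (simp add: gauss_int_diff Lambda_last)
  ultimately show ?thesis
    by (intro LambdaI[of _ e]) (auto simp: e_def ext_diff algebra_simps)
qed

lemma T_resp:
  assumes "x - y \<in> \<Lambda>"
  shows "T j b x - T j b y \<in> \<Lambda>"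
proof -
  obtain c where c: "c \<in> {0, w}" "\<And>i. ext (x - y) i - c \<in> gauss_int"
    using Lambda_ext[OF assms] by blast
  show ?thesis
  proof (rule LambdaI[OF _ c(1)])
    show "(T j b x - T j b y) $ f M \<in> gauss_int"
      using gauss_int_diff[OF gauss_int_zero Lambda_last[OF assms]] Lambda_last[OF assms] by (cases b) auto
    show "ext (T j b x - T j b y) i - c \<in> gauss_int" for i
      using c(2)[of "if b then j - i else i - j"] by (cases b) (auto simp: ext_diff ext_T)
  qed
qed

lemma T_zero: "T 0 False x - x \<in> \<Lambda>"
  by (rule LambdaI[of _ 0]) (auto simp: ext_diff ext_T)

lemma T_period: "T (2 * M) False x - x \<in> \<Lambda>"
proof (rule LambdaI[of _ 0])
  show "(T (2 * M) False x - x) $ f M \<in> gauss_int"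
    using M_pos by (simp add: gauss_int_def)
  show "ext (T (2 * M) False x - x) i - 0 \<in> gauss_int" for i
    using ext_shift[of x "i - 2 * M"] ext_shift[of x "i - M"]
    by (simp add: ext_diff ext_T algebra_simps)
qed simp

text \<open>For odd \<open>k\<close> the two values are \<open>1/2\<close> and \<open>\<i>/2\<close>
  in some order; either difference is \<open>w\<close> up to a Gaussian integer, and the sum, in
  \<open>a_plus\<close>, is \<open>w\<close> itself.\<close>

lemma a_minus: "a i - a (i + k) - (if even k then 0 else w) \<in> gauss_int"
  by (auto simp: a_def w_def gauss_int_def)

lemma a_plus: "a i + a (k - i) - (if even k then 0 else w) \<in> gauss_int"
  by (auto simp: a_def w_def gauss_int_def)

text \<open>A rotation on the left composes exactly. With a reflection on the left the terms in
  \<open>x\<close> cancel and two values of \<open>a\<close> remain, which give \<open>w\<close>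
  precisely for odd \<open>k\<close>; this is why \<open>(w, ..., w)\<close> is divided out.\<close>

lemma T_comp: "T j b (T k c x) - T (if b then j - k else j + k) (b \<noteq> c) x \<in> \<Lambda>"
proof (rule LambdaI[of _ "if b \<and> odd k then w else 0"])
  show "(T j b (T k c x) - T (if b then j - k else j + k) (b \<noteq> c) x) $ f M \<in> gauss_int"
    by (auto simp: add_divide_distrib diff_divide_distrib)
next
  fix i
  show "ext (T j b (T k c x) - T (if b then j - k else j + k) (b \<noteq> c) x) i
      - (if b \<and> odd k then w else 0) \<in> gauss_int"
  proof (cases b)
    case False
    then show ?thesis by (simp add: ext_diff ext_T algebra_simps)
  next
    case True
    show ?thesis
    proof (cases c)
      case True
      have "(ext \<alpha> (j - i - k) - a (j - i - k)) + (ext \<alpha> (i - j) - a (i - j))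
          + (a (i - j) + a (- k - (i - j)) - (if even (- k) then 0 else w)) \<in> gauss_int"
        by (intro gauss_int_add ext_alpha a_plus)
      with \<open>b\<close> True show ?thesis
        by (simp add: ext_diff ext_T algebra_simps split: if_splits)
    next
      case False
      have "(ext \<alpha> (i - j) - a (i - j)) - (ext \<alpha> (i - j + k) - a (i - j + k))
          + (a (i - j) - a (i - j + k) - (if even k then 0 else w)) \<in> gauss_int"
        by (rule gauss_int_add[OF gauss_int_diff[OF ext_alpha ext_alpha] a_minus])
      with \<open>b\<close> False show ?thesis
        by (simp add: ext_diff ext_T algebra_simps split: if_splits)
    qed
  qed
qed auto

lemma T_holomorphic: "holomorphic_map_on (T j b) UNIV"
proof -
  define D where "D x = T j b x - T j b 0" for x
  have add: "D (x + y) = D x + D y" and scale: "D (c *s x) = c *s D x" for c x y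
    by (auto simp: D_def vec_eq_iff T_def ext_add ext_scale algebra_simps)
  have "Vector_Spaces.linear (*s) (*s) D"
    by (simp add: Vector_Spaces.linear_iff vec.vector_space_axioms add scale)
  moreover have "linear D"
  proof (rule linearI)
    fix r :: real and x
    \<comment> \<open>\<open>has_derivative\<close> asks for real linearity, which follows by
      viewing real scalars as complex ones.\<close>
    have scaleR: "r *\<^sub>R y = complex_of_real r *s y" for y :: "complex ^ 'g"
      by (simp only: vec_eq_iff vector_scaleR_component vector_smult_component)
        (simp add: scaleR_conv_of_real)
    show "D (r *\<^sub>R x) = r *\<^sub>R D x"
      unfolding scaleR by (rule scale)
  qed (rule add)
  then have "((\<lambda>x. D x + T j b 0) has_derivative D) (at x)" for x
    by (intro has_derivative_add_const linear_imp_has_derivative)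
  then have "(T j b has_derivative D) (at x)" for x
    by (simp add: D_def)
  ultimately show ?thesis
    unfolding holomorphic_map_on_def by blast
qed

section \<open>Lattice property and polarization\<close>

text \<open>Both \<open>0\<close> and \<open>w\<close> double to Gaussian integers. Discreteness and
  integrality of the polarization rest on this bound for the denominators.\<close>

lemma twice_Lambda:
  assumes "x \<in> \<Lambda>"
  shows "2 * x $ p \<in> gauss_int"
proof (cases "p = f M")
  case True
  show ?thesis
    unfolding True mult_2 by (rule gauss_int_add[OF Lambda_last[OF assms] Lambda_last[OF assms]])
next
  case False
  obtain c where c: "c \<in> {0, w}" "\<And>i. ext x i - c \<in> gauss_int"
    using Lambda_ext[OF assms] by blast
  have "x $ p = ext x (index p)"
    using False index_less index_range by (simp add: ext_base)
  with c(2)[of "index p"] have "(x $ p - c) + (x $ p - c) + 2 * c \<in> gauss_int"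
    using c(1) two_w by (intro gauss_int_add) auto
  then show ?thesis by (simp add: algebra_simps)
qed

lemma Lambda_axis:
  assumes "c \<in> gauss_int"
  shows "axis p c \<in> \<Lambda>"
  using assms gauss_int_diff[OF gauss_int_zero assms]
  by (intro LambdaI[of _ 0]) (auto simp: ext_def axis_def)

lemma lattice_Lambda: "lattice_in \<Lambda>"
proof -
  have "discrete \<Lambda>"
    unfolding discrete_def isolated_in_dist_Ex_iff
  proof (intro ballI conjI exI[of _ "1/2"] impI)
    \<comment> \<open>A nonzero coordinate of a lattice vector is half a nonzero Gaussian integer,
      so its norm is at least \<open>1/2\<close>.\<close>
    fix x y assume xy: "x \<in> \<Lambda>" "y \<in> \<Lambda>" "dist x y < 1 / 2"
    show "y = x"
    proof (rule ccontr)
      assume "y \<noteq> x"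
      then obtain p where "x $ p \<noteq> y $ p" by (metis vec_eq_iff)
      then have p: "(x - y) $ p \<noteq> 0" by simp
      have "2 * (x - y) $ p \<in> gauss_int"
        by (rule twice_Lambda[OF Lambda_diff[OF xy(1,2)]])
      with p have "norm (2 * (x - y) $ p) \<ge> 1"
        by (intro norm_gauss_int) auto
      then have "2 * norm ((x - y) $ p) \<ge> 1"
        by (simp only: norm_mult norm_numeral)
      then show False
        using xy(3) Finite_Cartesian_Product.norm_nth_le[of "x - y" p] by (simp add: dist_norm)
    qed
  qed simp_all
  moreover have "span \<Lambda> = UNIV"
  proof -
    have "v \<in> \<Lambda>" if "v \<in> Basis" for v
    proof -
      have "\<exists>p u. u \<in> Basis \<and> v = axis p u"
        using that unfolding Basis_vec_def by blast
      then obtain p u where u: "u \<in> Basis" "v = axis p u" by blast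
      then have "u \<in> gauss_int"
        by (auto simp: Basis_complex_def gauss_int_def)
      then show ?thesis unfolding u(2) by (rule Lambda_axis)
    qed
    then have "span Basis \<subseteq> span \<Lambda>" by (intro span_mono subsetI)
    then show ?thesis unfolding span_Basis by blast
  qed
  ultimately show ?thesis
    unfolding lattice_in_def by (intro conjI ballI Lambda_zero Lambda_diff)
qed

text \<open>The standard Hermitian form, with a factor \<open>2\<close> for the denominators of each
  argument.\<close>

definition herm :: "complex ^ 'g \<Rightarrow> complex ^ 'g \<Rightarrow> complex" where
  "herm x y = 4 * (\<Sum>p\<in>UNIV. x $ p * cnj (y $ p))"

lemma polarization_herm: "polarization \<Lambda> herm"
proof -
  have "Vector_Spaces.linear (*s) (*) (\<lambda>x. herm x y)" for y
  proof -
    have "vector_space ((*) :: complex \<Rightarrow> complex \<Rightarrow> complex)"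
      by unfold_locales (auto simp: algebra_simps)
    moreover have "herm (x + z) y = herm x y + herm z y" for x z
      by (simp add: herm_def distrib_right distrib_left sum.distrib)
    moreover have "herm (c *s x) y = c * herm x y" for c x
      by (simp add: herm_def sum_distrib_left mult.assoc mult.left_commute)
    ultimately show ?thesis
      by (simp add: Vector_Spaces.linear_iff vec.vector_space_axioms)
  qed
  moreover have "herm y x = cnj (herm x y)" for x y
    by (simp add: herm_def mult.commute)
  moreover have "Re (herm x x) > 0" if x: "x \<noteq> 0" for x
  proof -
    obtain p where "x $ p \<noteq> 0" using x by (auto simp: vec_eq_iff)
    then have "(\<Sum>p\<in>UNIV. (norm (x $ p))\<^sup>2) > 0"
      by (intro sum_pos2[of _ p]) auto
    moreover have "Re (x $ p * cnj (x $ p)) = (norm (x $ p))\<^sup>2" for p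
      by (simp add: complex_mult_cnj cmod_power2)
    ultimately show ?thesis by (simp add: herm_def)
  qed
  moreover have "Im (herm x y) \<in> \<int>" if "x \<in> \<Lambda>" "y \<in> \<Lambda>" for x y
  proof -
    have "(\<Sum>p\<in>UNIV. (2 * x $ p) * cnj (2 * y $ p)) \<in> gauss_int"
      by (rule gauss_int_sum,
          rule gauss_int_mult[OF twice_Lambda[OF that(1)] gauss_int_cnj[OF twice_Lambda[OF that(2)]]])
    also have "(\<Sum>p\<in>UNIV. (2 * x $ p) * cnj (2 * y $ p)) = herm x y"
      by (simp add: herm_def sum_distrib_left mult.assoc)
    finally show ?thesis by (simp add: gauss_int_def)
  qed
  ultimately show ?thesis
    unfolding polarization_def by (intro conjI allI impI ballI)
qed

lemma abelian_variety_Lambda: "abelian_variety \<Lambda>"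
  using lattice_Lambda polarization_herm by (auto simp: abelian_variety_def)

section \<open>Freeness and absence of translations\<close>

lemma rotation_free:
  assumes "\<not> 2 * M dvd j"
  shows "T j False x - x \<notin> \<Lambda>"
proof
  assume "T j False x - x \<in> \<Lambda>"
  then have "complex_of_real (of_int j / of_int (2 * M)) \<in> gauss_int"
    by (auto dest: Lambda_last)
  then obtain q :: int where "real_of_int j / of_int (2 * M) = of_int q"
    by (auto simp: gauss_int_def elim: Ints_cases)
  then have "real_of_int j = of_int (2 * M * q)"
    using M_pos by (simp add: field_simps)
  then have "j = 2 * M * q" by (simp only: of_int_eq_iff)
  with assms show False by simp
qed

lemma reflection_free: "T j True x - x \<notin> \<Lambda>"
proof
  assume "T j True x - x \<in> \<Lambda>"
  then obtain c where c: "c \<in> {0, w}" "\<And>i. ext (T j True x - x) i - c \<in> gauss_int"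
    using Lambda_ext by blast
  have h: "ext x (j - i) + a (i - j) - ext x i - c \<in> gauss_int" for i
    using gauss_int_diff[OF c(2)[of i] ext_alpha[of "i - j"]]
    by (simp add: ext_diff ext_T algebra_simps)
  show False
  proof (cases "even j")
    case True
    then obtain l where j: "j = 2 * l" by blast
    \<comment> \<open>The reflection \<open>i \<mapsto> j - i\<close> fixes the index
      \<open>l\<close>, so \<open>x\<close> cancels; the remaining value of \<open>a\<close> is
      neither \<open>0\<close> nor \<open>w\<close> modulo Gaussian integers.\<close>
    have "a (- l) - c \<in> gauss_int"
      using h[of l] by (simp add: j)
    then show False
      using c(1) by (auto simp: a_def w_def gauss_int_def not_Ints_real split: if_splits)
  next
    case False
    then obtain l where j: "j = 2 * l + 1" by (blast elim: oddE)
    \<comment> \<open>The reflection swaps the coordinates \<open>l\<close> and \<open>l + 1\<close>, so \<open>x\<close> cancels in the sum.\<close>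
    have "a (- l) + a (- 1 - l) - 2 * c \<in> gauss_int"
      using gauss_int_add[OF h[of l] h[of "l + 1"]] by (simp add: j algebra_simps)
    \<comment> \<open>Consecutive values of \<open>a\<close> add up to \<open>w\<close>, while
      \<open>2 * c\<close> is Gaussian.\<close>
    then show False
      using c(1) by (auto simp: a_def w_def gauss_int_def not_Ints_real split: if_splits)
  qed
qed

lemma reflection_no_translation: "\<exists>x. T j True x - (x + v) \<notin> \<Lambda>"
proof (rule ccontr)
  assume "\<not> ?thesis"
  then have *: "T j True x - (x + v) \<in> \<Lambda>" for x by blast
  \<comment> \<open>Comparing two points removes \<open>v\<close> and leaves only the linear
    part.\<close>
  have "(T j True 0 - (0 + v)) - (T j True (axis (f M) (1/8)) - (axis (f M) (1/8) + v)) \<in> \<Lambda>"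
    by (rule Lambda_diff[OF * *])
  \<comment> \<open>The last coordinate of \<open>T j True x - x\<close> is \<open>-2 x $ f M\<close> up to a constant.\<close>
  then have "(1/4 :: complex) \<in> gauss_int"
    by (auto dest!: Lambda_last simp: axis_def)
  then show False by (simp add: gauss_int_def not_Ints_real)
qed

lemma rotation_no_translation:
  assumes "\<not> 2 * M dvd j"
  shows "\<exists>x. T j False x - (x + v) \<notin> \<Lambda>"
proof (rule ccontr)
  assume "\<not> ?thesis"
  then have *: "T j False x - (x + v) \<in> \<Lambda>" for x by blast
  \<comment> \<open>With the entry \<open>1/8\<close> the doubled coordinate below is
    \<open>-1/4\<close> or \<open>-1/2\<close>, and neither is Gaussian.\<close>
  define x :: "complex ^ 'g" where "x = axis (f 0) (1/8)"
  have "(T j False x - (x + v)) - (T j False 0 - (0 + v)) \<in> \<Lambda>" (is "?d \<in> _")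
    by (rule Lambda_diff[OF * *])
  then have "2 * ?d $ f 0 \<in> gauss_int" by (rule twice_Lambda)
  moreover have "?d $ f 0 = ext ?d 0" using M_pos by (simp add: ext_base)
  moreover have "ext ?d 0 = ext x (- j) - 1/8"
    using M_pos by (simp add: ext_diff ext_add ext_T ext_base x_def)
  ultimately have "2 * (ext x (- j) - 1/8) \<in> gauss_int" by (simp only:)
  moreover have "ext x (- j) = 0 \<or> ext x (- j) = - (1/8)"
  proof (cases "(- j) mod M = 0")
    case True
    then have "- j = M * ((- j) div M)" by (metis add.right_neutral mult_div_mod_eq)
    \<comment> \<open>Here \<open>j\<close> is an odd multiple of \<open>M\<close>, so the rotation
      is \<open>-1\<close> on the first \<open>M\<close> coordinates.\<close>
    with assms have "odd ((- j) div M)"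
      by (metis dvd_minus_iff dvd_mult_cancel_left dvd_triv_left evenE mult.assoc mult.commute)
    with True show ?thesis by (simp add: ext_def x_def)
  next
    case False
    have "0 \<le> (- j) mod M" "(- j) mod M < M" using M_pos by auto
    with False have "f ((- j) mod M) \<noteq> f 0"
      using index_f[of "(- j) mod M"] index_f[of 0] M_pos by (metis less_imp_le order_refl)
    then show ?thesis by (simp add: ext_def x_def axis_def)
  qed
  ultimately show False
    by (auto simp: gauss_int_def not_Ints_real)
qed

end

section \<open>Restriction from rotations of order \<open>lcm 4 n\<close> to order
  \<open>n\<close>\<close>

theorem mainTheorem2:
  fixes n :: nat
  assumes "n \<ge> 1"
    and "CARD('g::finite) = lcm 4 n div 2 + 1"
  shows "\<exists>(\<Lambda> :: (complex ^ 'g) set) \<phi>.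
    abelian_variety \<Lambda> \<and>
    torus_action (dihedral_group n) \<Lambda> \<phi> \<and>
    free_action (dihedral_group n) (torus \<Lambda>) \<phi> \<and>
    contains_no_translations (dihedral_group n) \<Lambda> \<phi>"
proof -
  define M where "M = int (lcm 4 n div 2)"
  have dvd4: "4 dvd lcm 4 n" and dvdn: "n dvd lcm 4 n" by simp_all
  have pos: "lcm 4 n > 0" using assms(1) by (simp add: lcm_pos_nat)
  obtain q where q: "lcm 4 n = 4 * q" using dvd4 by blast
  \<comment> \<open>The factor \<open>4\<close> in the least common multiple makes \<open>M\<close>
    even.\<close>
  have M: "M = 2 * int q" by (simp add: M_def q)
  obtain d where d: "lcm 4 n = n * d" using dvdn by blast
  have Md: "2 * M = int n * int d"
    using M q d by (metis mult.assoc numeral_Bit0_eq_double of_nat_mult of_nat_numeral)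
  have "d > 0" using pos d by (cases d) auto
  have "card {0..M} = CARD('g)"
    using assms(2) by (simp add: M_def)
  then obtain f :: "int \<Rightarrow> 'g" where f: "bij_betw f {0..M} UNIV"
    using finite_same_card_bij[of "{0..M}" "UNIV :: 'g set"] by auto
  interpret shift_torus M f
    using f pos q M by unfold_locales auto
  \<comment> \<open>The generator \<open>r\<close> of \<open>D_n\<close> acts as the
    \<open>d\<close>-th power of the rotation of order \<open>2 * M = n * d\<close>.\<close>
  interpret torus_dihedral \<Lambda> n "\<lambda>j. T (int d * j)"
  proof
    show "T (int d * j) b (T (int d * k) c x) - T (int d * (if b then j - k else j + k)) (b \<noteq> c) x \<in> \<Lambda>"
      for j b k c x
      using T_comp[of "int d * j" b "int d * k" c x] by (simp add: algebra_simps split: if_splits)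
    show "T (int d * int n) False x - x \<in> \<Lambda>" for x
      using T_period[of x] unfolding Md by (simp only: mult.commute)
  qed (use assms(1) Lambda_zero Lambda_diff T_holomorphic T_resp T_zero in auto)
  have "\<not> 2 * M dvd int d * j" if "\<not> int n dvd j" for j
    using that \<open>d > 0\<close> unfolding Md by (simp add: mult.commute)
  then have "free_action (dihedral_group n) (torus \<Lambda>) dihedral_act"
    and "contains_no_translations (dihedral_group n) \<Lambda> dihedral_act"
    using rotation_free reflection_free rotation_no_translation reflection_no_translation
    by (metis (full_types) dihedral_free_action, metis (full_types) dihedral_no_translations)
  with abelian_variety_Lambda dihedral_torus_action show ?thesis by blast
qed

end
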